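(* For an arbitrary continuous time chain $\{A(t)\}_{t\ge0}$ of $N\times N$ matrices, $\mathbf{rank}(A)$ is less than or equal to the number of ergodicity classes of $\{A(t)\}$.
   Context: Let $\mathcal V=\{1,\dots,N\}$. A continuous time chain $\{A(t)\}_{t\ge0}$ is a family of real $N\times N$ matrices with zero row sums and non-negative off-diagonal entries, whose entries are measurable and locally integrable functions of $t\in[0,\infty)$. Let $\Phi(t,\tau)$, $t\ge\tau\ge0$, be the state transition matrix of $\dot x(t)=A(t)x(t)$, so $x(t)=\Phi(t,\tau)x(\tau)$; it is invertible and row-stochastic. Rank: for $\tau\ge0$ let $\mathbf{null}_\tau(A)=\{v\in\mathbb R^N : \lim_{t\to\infty}\Phi(t,\tau)v=\mathbf 0_N\}$. This is a vector space whose dimension does not depend on $\tau$; this dimension is $\mathbf{nullity}(A)$, and $\mathbf{rank}(A)=N-\mathbf{nullity}(A)$. Ergodicity classes: let $\Phi'_i(t,\tau)$ denote the $i$th column of the transpose of $\Phi(t,\tau)$ (the $i$th row of $\Phi(t,\tau)$). Two indices $i,j\in\mathcal V$ are mutually weakly ergodic if $\lim_{t\to\infty}\|\Phi'_i(t,\tau)-\Phi'_j(t,\tau)\|=0$ for every $\tau\ge0$. This is an equivalence relation on $\mathcal V$; its equivalence classes are the ergodicity classes of $\{A(t)\}$. *)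

theory Defs
  imports "HOL-Analysis.Analysis"
begin

text \<open>
  The index set \<open>{1..N}\<close> is a finite type \<open>'n\<close>, with \<open>N = CARD('n)\<close>. Chains are functions on all
  of \<open>real\<close>, but only their values at \<open>t \<ge> 0\<close> are ever used.
  Absolute integrability on \<open>{0..T}\<close> is Lebesgue integrability there and includes measurability.
\<close>

definition continuous_time_chain :: "(real \<Rightarrow> real ^ 'n ^ 'n) \<Rightarrow> bool" where
  "continuous_time_chain A \<longleftrightarrow>
     (\<forall>t\<ge>0. \<forall>i. (\<Sum>j\<in>UNIV. A t $ i $ j) = 0) \<and>
     (\<forall>t\<ge>0. \<forall>i j. i \<noteq> j \<longrightarrow> A t $ i $ j \<ge> 0) \<and>
     (\<forall>i j. \<forall>T\<ge>0. (\<lambda>t. A t $ i $ j) absolutely_integrable_on {0..T})"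

text \<open>
  As \<open>A\<close> is merely locally integrable, solutions are understood in the sense of Caratheodory:
  \<open>X\<close> solves \<open>X'(t) = A(t) X(t)\<close>, \<open>X(\<tau>) = I\<close> on \<open>{\<tau>..}\<close> iff \<open>X(t) = I + \<integral>\<^sub>\<tau>\<^sup>t A(s) X(s) ds\<close> for all
  \<open>t \<ge> \<tau>\<close>. Continuity of \<open>X\<close> on \<open>{\<tau>..}\<close> is a consequence of this equation.
\<close>

definition fundamental_solution ::
    "(real \<Rightarrow> real ^ 'n ^ 'n) \<Rightarrow> real \<Rightarrow> (real \<Rightarrow> real ^ 'n ^ 'n) \<Rightarrow> bool" where
  "fundamental_solution A \<tau> X \<longleftrightarrow>
     (\<forall>t\<ge>\<tau>. ((\<lambda>s. A s ** X s) has_integral (X t - mat 1)) {\<tau>..t})"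

text \<open>
  A fundamental solution is unique only on \<open>{\<tau>..}\<close>, hence the description of its value at \<open>t\<close>
  rather than of the function. Meaningful for \<open>t \<ge> \<tau> \<ge> 0\<close>.
\<close>

definition state_transition ::
    "(real \<Rightarrow> real ^ 'n ^ 'n) \<Rightarrow> real \<Rightarrow> real \<Rightarrow> real ^ 'n ^ 'n" where
  "state_transition A t \<tau> = (THE M. \<exists>X. fundamental_solution A \<tau> X \<and> X t = M)"

definition null_space_at :: "(real \<Rightarrow> real ^ 'n ^ 'n) \<Rightarrow> real \<Rightarrow> (real ^ 'n) set" where
  "null_space_at A \<tau> = {v. ((\<lambda>t. state_transition A t \<tau> *v v) \<longlongrightarrow> 0) at_top}"

text \<open>The common dimension of the null spaces at all times \<open>\<tau> \<ge> 0\<close>.\<close>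

definition nullity :: "(real \<Rightarrow> real ^ 'n ^ 'n) \<Rightarrow> nat" where
  "nullity A = (THE d. \<forall>\<tau>\<ge>0. dim (null_space_at A \<tau>) = d)"

text \<open>Not to be confused with the library's \<open>rank\<close> of a single matrix.\<close>

definition chain_rank :: "(real \<Rightarrow> real ^ 'n ^ 'n) \<Rightarrow> nat" where
  "chain_rank A = CARD('n) - nullity A"

definition mutually_weakly_ergodic :: "(real \<Rightarrow> real ^ 'n ^ 'n) \<Rightarrow> 'n \<Rightarrow> 'n \<Rightarrow> bool" where
  "mutually_weakly_ergodic A i j \<longleftrightarrow>
     (\<forall>\<tau>\<ge>0. ((\<lambda>t. norm (row i (state_transition A t \<tau>) - row j (state_transition A t \<tau>)))
        \<longlongrightarrow> 0) at_top)"

definition ergodicity_classes :: "(real \<Rightarrow> real ^ 'n ^ 'n) \<Rightarrow> 'n set set" where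
  "ergodicity_classes A = UNIV // {(i, j). mutually_weakly_ergodic A i j}"

end

theory Submission
  imports Defs
begin

text \<open>
  The maps \<open>\<Phi>(t,s)\<close> are nonexpansive for the sup-norm, so for fixed \<open>v\<close> the sup-norm of
  \<open>\<Phi>(t,0) v\<close> is nonincreasing in \<open>t\<close>, and it suffices to see it vanish along one sequence of times.
  By compactness \<open>\<Phi>(t\<^sub>n,0)\<close> converges to some matrix \<open>M\<close> along a sequence \<open>t\<^sub>n\<close> tending to infinity;
  hence the kernel of \<open>M\<close> is contained in the null space. Rows of \<open>M\<close> belonging to the same ergodicity
  class coincide, so the rank of \<open>M\<close> is at most the number of classes.
\<close>

section \<open>Caratheodory solutions\<close>

text \<open>The integral equation is demanded between all pairs of times, not only from
  \<open>a\<close>, so that restricting and gluing solutions is immediate. For \<open>b < a\<close>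
  the condition is vacuous.\<close>

definition solution_on ::
    "(real \<Rightarrow> real ^ 'n ^ 'n) \<Rightarrow> real \<Rightarrow> real \<Rightarrow> (real \<Rightarrow> real ^ 'n) \<Rightarrow> bool" where
  "solution_on A a b x \<longleftrightarrow>
     (\<forall>s t. a \<le> s \<longrightarrow> s \<le> t \<longrightarrow> t \<le> b \<longrightarrow> ((\<lambda>r. A r *v x r) has_integral (x t - x s)) {s..t})"

lemma solution_onD:
  assumes "solution_on A a b x" "a \<le> s" "s \<le> t" "t \<le> b"
  shows "((\<lambda>r. A r *v x r) has_integral (x t - x s)) {s..t}"
  using assms unfolding solution_on_def by blast

lemma solution_on_subinterval:
  "solution_on A a b x \<Longrightarrow> a \<le> c \<Longrightarrow> d \<le> b \<Longrightarrow> solution_on A c d x"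
  unfolding solution_on_def by auto

text \<open>Additivity of the integral: subtracting the equations on \<open>{a..s}\<close> and
  \<open>{a..t}\<close> yields the one on \<open>{s..t}\<close>.\<close>

lemma solution_on_initialI:
  fixes x :: "real \<Rightarrow> real ^ 'n"
  assumes "\<And>t. a \<le> t \<Longrightarrow> t \<le> b \<Longrightarrow> ((\<lambda>r. A r *v x r) has_integral (x t - x a)) {a..t}"
  shows "solution_on A a b x"
  unfolding solution_on_def
proof (intro allI impI)
  fix s t assume st: "a \<le> s" "s \<le> t" "t \<le> b"
  let ?f = "\<lambda>r. A r *v x r"
  have s: "(?f has_integral (x s - x a)) {a..s}" and t: "(?f has_integral (x t - x a)) {a..t}"
    using assms st by auto
  have int: "?f integrable_on {s..t}"
    using t st by (meson atLeastatMost_subset_iff has_integral_integrable integrable_subinterval_real order_refl)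
  have "integral {a..s} ?f + integral {s..t} ?f = integral {a..t} ?f"
    using st t by (intro Henstock_Kurzweil_Integration.integral_combine) auto
  then have "integral {s..t} ?f = x t - x s"
    using s t by (simp add: integral_unique algebra_simps)
  with int show "(?f has_integral (x t - x s)) {s..t}"
    using integrable_integral by fastforce
qed

lemma solution_on_cong:
  assumes "solution_on A a b x" "\<And>t. a \<le> t \<Longrightarrow> t \<le> b \<Longrightarrow> x t = y t"
  shows "solution_on A a b y"
  unfolding solution_on_def
proof (intro allI impI)
  fix s t assume st: "a \<le> s" "s \<le> t" "t \<le> b"
  have "((\<lambda>r. A r *v y r) has_integral (x t - x s)) {s..t}"
    using solution_onD[OF assms(1) st] by (rule has_integral_eq[rotated]) (use assms(2) st in auto)
  then show "((\<lambda>r. A r *v y r) has_integral (y t - y s)) {s..t}"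
    using assms(2) st by auto
qed

lemma solution_on_glue:
  assumes x: "solution_on A a b x" and y: "solution_on A b c y" and eq: "x b = y b"
    and "a \<le> b" "b \<le> c"
  shows "solution_on A a c (\<lambda>t. if t \<le> b then x t else y t)" (is "solution_on A a c ?z")
proof (rule solution_on_initialI)
  have zx: "solution_on A a b ?z"
    by (rule solution_on_cong[OF x]) auto
  have zy: "solution_on A b c ?z"
    by (rule solution_on_cong[OF y]) (use eq in auto)
  fix t assume t: "a \<le> t" "t \<le> c"
  show "((\<lambda>r. A r *v ?z r) has_integral (?z t - ?z a)) {a..t}"
  proof (cases "t \<le> b")
    case True
    then show ?thesis using solution_onD[OF zx _ t(1)] by blast
  next
    case False
    then have "((\<lambda>r. A r *v ?z r) has_integral ((?z b - ?z a) + (?z t - ?z b))) {a..t}"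
      using \<open>a \<le> b\<close> t
      by (intro has_integral_combine[of a b t] solution_onD[OF zx] solution_onD[OF zy]) auto
    moreover have "(?z b - ?z a) + (?z t - ?z b) = ?z t - ?z a"
      by (simp add: algebra_simps)
    ultimately show ?thesis by (simp only:)
  qed
qed

lemma solution_on_diff:
  assumes "solution_on A a b x" "solution_on A a b y"
  shows "solution_on A a b (\<lambda>t. x t - y t)"
  unfolding solution_on_def
proof (intro allI impI)
  fix s t assume st: "a \<le> s" "s \<le> t" "t \<le> b"
  show "((\<lambda>r. A r *v (x r - y r)) has_integral (x t - y t - (x s - y s))) {s..t}"
    using has_integral_diff[OF solution_onD[OF assms(1) st] solution_onD[OF assms(2) st]]
    by (simp add: matrix_vector_mult_diff_distrib algebra_simps)
qed

text \<open>A solution differs from a constant by an indefinite integral.\<close>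

lemma solution_on_continuous:
  assumes "solution_on A a b x"
  shows "continuous_on {a..b} x"
proof (cases "a \<le> b")
  case True
  let ?f = "\<lambda>r. A r *v x r"
  have x_eq: "x t = x a + integral {a..t} ?f" if "t \<in> {a..b}" for t
    using solution_onD[OF assms, of a t] that by (simp add: integral_unique)
  have "continuous_on {a..b} (\<lambda>t. x a + integral {a..t} ?f)"
    using solution_onD[OF assms order_refl True]
    by (intro continuous_intros indefinite_integral_continuous_1) auto
  then show ?thesis
    by (rule continuous_on_eq) (use x_eq in metis)
qed auto

lemma solution_on_sup_attained:
  assumes "solution_on A a b x" "a \<le> b"
  obtains c where "a \<le> c" "c \<le> b" "\<And>t. a \<le> t \<Longrightarrow> t \<le> b \<Longrightarrow> norm (x t) \<le> norm (x c)"
proof -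
  have "continuous_on {a..b} (\<lambda>t. norm (x t))"
    by (intro continuous_on_norm solution_on_continuous[OF assms(1)])
  then obtain c where "c \<in> {a..b}" "\<forall>t\<in>{a..b}. norm (x t) \<le> norm (x c)"
    using continuous_attains_sup[of "{a..b}" "\<lambda>t. norm (x t)"] assms(2) by auto
  then show ?thesis using that by auto
qed

section \<open>Integration by components\<close>

lemma has_integral_vecI:
  fixes f :: "real \<Rightarrow> 'a::euclidean_space ^ 'k"
  assumes "\<And>i. ((\<lambda>t. f t $ i) has_integral (y $ i)) S"
  shows "(f has_integral y) S"
  unfolding has_integral_componentwise_iff[of f]
proof
  fix b :: "'a ^ 'k" assume "b \<in> Basis"
  then obtain i u where b: "b = axis i u" by (auto simp: Basis_vec_def)
  show "((\<lambda>t. f t \<bullet> b) has_integral (y \<bullet> b)) S"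
    using has_integral_linear[OF assms[of i] bounded_linear_inner_left[of u]]
    by (simp add: b o_def inner_axis)
qed

lemma integrable_vecI:
  fixes f :: "real \<Rightarrow> 'a::euclidean_space ^ 'k"
  assumes "\<And>i. (\<lambda>t. f t $ i) integrable_on S"
  shows "f integrable_on S"
proof -
  have "(f has_integral (\<chi> i. integral S (\<lambda>t. f t $ i))) S"
    by (rule has_integral_vecI) (use assms in auto)
  then show ?thesis by blast
qed

section \<open>Ergodicity classes, rows and kernels of matrices\<close>

lemma mutually_weakly_ergodic_refl: "mutually_weakly_ergodic A i i"
  by (simp add: mutually_weakly_ergodic_def)

text \<open>Send each class to the row of a chosen member. The class of \<open>i\<close> is nonempty
  by reflexivity, and its chosen member is ergodic with \<open>i\<close>, so row \<open>i\<close> is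
  attained and the map covers all rows.\<close>

lemma card_rows_le_classes:
  assumes "\<And>i j. mutually_weakly_ergodic A i j \<Longrightarrow> row i M = row j M"
  shows "card (rows M) \<le> card (ergodicity_classes A)"
proof -
  let ?R = "{(i, j). mutually_weakly_ergodic A i j}"
  have "rows M \<subseteq> (\<lambda>C. row (SOME k. k \<in> C) M) ` ergodicity_classes A"
  proof
    fix v assume "v \<in> rows M"
    then obtain i where v: "v = row i M" by (auto simp: rows_def)
    have "(SOME k. k \<in> ?R `` {i}) \<in> ?R `` {i}"
      by (rule someI[of _ i]) (simp add: mutually_weakly_ergodic_refl)
    then have "v = row (SOME k. k \<in> ?R `` {i}) M"
      using assms v by (metis (no_types, lifting) Image_singleton_iff case_prodD mem_Collect_eq)
    moreover have "?R `` {i} \<in> ergodicity_classes A"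
      unfolding ergodicity_classes_def by (rule quotientI) simp
    ultimately show "v \<in> (\<lambda>C. row (SOME k. k \<in> C) M) ` ergodicity_classes A"
      by (rule image_eqI)
  qed
  moreover have "finite (ergodicity_classes A)"
    by (rule finite)
  ultimately show ?thesis
    by (meson card_image_le card_mono finite_imageI order_trans)
qed

text \<open>The orthogonal complement of the row space lies in the kernel. As \<open>rows M\<close>
  is a set, equal rows count once, which is what makes the bound useful here.\<close>

lemma card_le_dim_kernel_plus_rows:
  fixes M :: "real ^ 'k ^ 'm"
  shows "CARD('k) \<le> dim {v. M *v v = 0} + card (rows M)"
proof -
  have "dim {y \<in> UNIV. \<forall>x \<in> span (rows M). orthogonal x y} + dim (span (rows M)) = dim (UNIV :: (real^'k) set)"
    by (rule dim_subspace_orthogonal_to_vectors) auto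
  moreover have "{y \<in> UNIV. \<forall>x \<in> span (rows M). orthogonal x y} \<subseteq> {v. M *v v = 0}"
    by (auto simp: vec_eq_iff matrix_vector_mul_component rows_def orthogonal_def row_def
        vec_lambda_eta intro: span_base)
  then have "dim {y \<in> UNIV. \<forall>x \<in> span (rows M). orthogonal x y} \<le> dim {v. M *v v = 0}"
    by (rule dim_subset)
  moreover have "dim (span (rows M)) \<le> card (rows M)"
    unfolding dim_span by (rule dim_le_card') (simp add: rows_def full_SetCompr_eq)
  ultimately show ?thesis by simp
qed

section \<open>Integral estimates for a chain\<close>

locale time_chain =
  fixes A :: "real \<Rightarrow> real ^ 'n ^ 'n"
  assumes chain: "continuous_time_chain A"
begin

text \<open>The entrywise l1-norm of \<open>A t\<close>: a locally integrable majorant of its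
  operator norm.\<close>

definition mass :: "real \<Rightarrow> real" where
  "mass t = (\<Sum>i\<in>UNIV. \<Sum>j\<in>UNIV. \<bar>A t $ i $ j\<bar>)"

lemma mass_nonneg: "0 \<le> mass t"
  by (simp add: mass_def sum_nonneg)

lemma norm_chain_mult: "norm (A t *v x) \<le> mass t * norm x"
proof -
  have "norm (A t *v x) \<le> (\<Sum>i\<in>UNIV. \<bar>(A t *v x) $ i\<bar>)"
    by (rule norm_le_l1_cart)
  also have "\<dots> \<le> (\<Sum>i\<in>UNIV. \<Sum>j\<in>UNIV. \<bar>A t $ i $ j\<bar> * norm x)"
    unfolding matrix_vector_mult_def
    by (auto intro!: sum_mono order_trans[OF sum_abs] mult_left_mono component_le_norm_cart
        simp: abs_mult)
  finally show ?thesis by (simp add: mass_def sum_distrib_right)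
qed

lemma entry_absolutely_integrable:
  assumes "0 \<le> a"
  shows "(\<lambda>t. A t $ i $ j) absolutely_integrable_on {a..b}"
proof (cases "a \<le> b")
  case True
  then have "(\<lambda>t. A t $ i $ j) absolutely_integrable_on {0..b}"
    using chain assms unfolding continuous_time_chain_def by auto
  then show ?thesis
    by (rule absolutely_integrable_on_subinterval) (use assms in auto)
qed auto

lemma abs_entry_integrable: "0 \<le> a \<Longrightarrow> (\<lambda>t. \<bar>A t $ i $ j\<bar>) integrable_on {a..b}"
  by (rule set_lebesgue_integral_eq_integral(1))
    (use absolutely_integrable_norm[OF entry_absolutely_integrable, of a] in \<open>simp add: o_def\<close>)

lemma mass_integrable: "0 \<le> a \<Longrightarrow> mass integrable_on {a..b}"
  unfolding mass_def[abs_def] by (intro integrable_sum abs_entry_integrable) auto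

text \<open>Each summand is a bounded measurable function (a component of \<open>x\<close>) times an
  absolutely integrable one (an entry of \<open>A\<close>).\<close>

lemma chain_mult_integrable:
  assumes "0 \<le> a" "continuous_on {a..b} x"
  shows "(\<lambda>t. A t *v x t) integrable_on {a..b}"
proof (rule integrable_vecI)
  fix i
  have "(\<lambda>t. x t $ j * A t $ i $ j) absolutely_integrable_on {a..b}" for j
  proof (rule absolutely_integrable_bounded_measurable_product_real)
    have c: "continuous_on {a..b} (\<lambda>t. x t $ j)"
      by (intro continuous_intros assms)
    then show "(\<lambda>t. x t $ j) \<in> borel_measurable (lebesgue_on {a..b})"
      by (rule continuous_imp_measurable_on_sets_lebesgue) auto
    show "bounded ((\<lambda>t. x t $ j) ` {a..b})"
      by (intro compact_imp_bounded compact_continuous_image c) auto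
  qed (use entry_absolutely_integrable assms in auto)
  then show "(\<lambda>t. (A t *v x t) $ i) integrable_on {a..b}"
    unfolding matrix_vector_mult_def
    by (auto intro!: integrable_sum simp: mult.commute set_lebesgue_integral_eq_integral(1))
qed

text \<open>The factor 1/2 on intervals of small mass makes the integral operator a contraction;
  existence and uniqueness on short intervals both rest on it.\<close>

lemma norm_integral_chain_mult_le:
  assumes "0 \<le> a" "a \<le> s" "t \<le> b" "integral {a..b} mass \<le> 1/2"
    and int: "(\<lambda>r. A r *v x r) integrable_on {s..t}"
    and M: "\<And>r. s \<le> r \<Longrightarrow> r \<le> t \<Longrightarrow> norm (x r) \<le> M" "0 \<le> M"
  shows "norm (integral {s..t} (\<lambda>r. A r *v x r)) \<le> M / 2"
proof -
  have "norm (integral {s..t} (\<lambda>r. A r *v x r)) \<le> integral {s..t} (\<lambda>r. mass r * M)"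
  proof (rule Henstock_Kurzweil_Integration.integral_norm_bound_integral[OF int])
    show "(\<lambda>r. mass r * M) integrable_on {s..t}"
      using mass_integrable[of s t] assms by (auto intro: integrable_on_mult_left)
    show "norm (A r *v x r) \<le> mass r * M" if "r \<in> {s..t}" for r
      using that norm_chain_mult[of r "x r"] M mult_left_mono[OF _ mass_nonneg]
      by (meson atLeastAtMost_iff order_trans)
  qed
  also have "\<dots> = integral {s..t} mass * M" by simp
  also have "integral {s..t} mass \<le> integral {a..b} mass"
    by (rule integral_subset_le) (use assms mass_integrable mass_nonneg in auto)
  then have "integral {s..t} mass * M \<le> (1/2) * M"
    using assms M by (intro mult_right_mono) auto
  finally show ?thesis by simp
qed

section \<open>Existence, uniqueness and positivity on short intervals\<close>

text \<open>Picard's argument: the integral operator is a contraction with constant 1/2 on bounded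
  continuous functions, and its fixed point is the solution.\<close>

lemma local_existence:
  assumes ab: "0 \<le> a" "a \<le> b" "integral {a..b} mass \<le> 1/2"
  shows "\<exists>x. solution_on A a b x \<and> x a = v"
proof -
  \<comment> \<open>Clamping time to \<open>{a..b}\<close> lets the operator act on bounded
    continuous functions on the whole line, a complete metric type to which the Banach fixed point
    theorem applies.\<close>
  define c where "c t = max a (min b t)" for t
  have c: "a \<le> c t" "c t \<le> b" for t using ab by (auto simp: c_def)
  define h where "h g t = v + integral {a..c t} (\<lambda>s. A s *v apply_bcontfun g s)" for g t
  have int: "(\<lambda>s. A s *v apply_bcontfun g s) integrable_on {a..t}" for g t
    using ab by (intro chain_mult_integrable) auto
  have h: "h g \<in> bcontfun" for g
  proof (rule bcontfun_normI)
    have "continuous_on {a..b} (\<lambda>t. integral {a..t} (\<lambda>s. A s *v apply_bcontfun g s))"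
      by (intro indefinite_integral_continuous_1 int)
    moreover have "continuous_on UNIV c"
      unfolding c_def by (intro continuous_intros)
    ultimately show "continuous_on UNIV (h g)"
      unfolding h_def using c
      by (intro continuous_intros continuous_on_compose2[where g="\<lambda>t. integral {a..t} _" and f=c]) auto
    show "norm (h g t) \<le> norm v + norm g / 2" for t
      unfolding h_def
      by (rule order_trans[OF norm_triangle_ineq], rule add_left_mono,
          rule norm_integral_chain_mult_le[OF ab(1) _ c(2) ab(3) int]) (auto simp: norm_bounded)
  qed
  define T where "T g = Bcontfun (h g)" for g
  have T: "apply_bcontfun (T g) = h g" for g
    unfolding T_def using h by (rule Bcontfun_inverse)
  have "\<forall>f g. dist (T f) (T g) \<le> 1/2 * dist f g"
  proof (intro allI dist_bound)
    fix f g t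
    have "h f t - h g t = integral {a..c t} (\<lambda>s. A s *v (apply_bcontfun f s - apply_bcontfun g s))"
      unfolding h_def matrix_vector_mult_diff_distrib by (simp add: integral_diff int)
    moreover have "norm \<dots> \<le> dist f g / 2"
    proof (rule norm_integral_chain_mult_le[OF ab(1) order_refl c(2) ab(3)])
      show "(\<lambda>s. A s *v (apply_bcontfun f s - apply_bcontfun g s)) integrable_on {a..c t}"
        using ab by (intro chain_mult_integrable continuous_intros) auto
    qed (use dist_bounded in \<open>auto simp: dist_norm[symmetric]\<close>)
    ultimately show "dist (apply_bcontfun (T f) t) (apply_bcontfun (T g) t) \<le> 1/2 * dist f g"
      by (simp add: T dist_norm)
  qed
  then obtain g where g: "T g = g"
    using banach_fix_type[of "1/2" T] by auto
  have eq: "apply_bcontfun g t = v + integral {a..t} (\<lambda>s. A s *v apply_bcontfun g s)"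
    if "a \<le> t" "t \<le> b" for t
  proof -
    have "c t = t" using that by (auto simp: c_def)
    moreover have "apply_bcontfun (T g) t = h g t" by (simp only: T)
    ultimately show ?thesis by (simp only: g h_def)
  qed
  then have ga: "apply_bcontfun g a = v" using eq[OF order_refl ab(2)] by simp
  have "solution_on A a b (apply_bcontfun g)"
  proof (rule solution_on_initialI)
    fix t assume t: "a \<le> t" "t \<le> b"
    have "apply_bcontfun g t - apply_bcontfun g a = integral {a..t} (\<lambda>s. A s *v apply_bcontfun g s)"
      by (subst eq[OF t]) (simp add: ga)
    then show "((\<lambda>r. A r *v apply_bcontfun g r) has_integral (apply_bcontfun g t - apply_bcontfun g a)) {a..t}"
      using integrable_integral[OF int[of g t]] by (simp only:)
  qed
  with ga show ?thesis by blast
qed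

text \<open>Between the zero \<open>c\<close> and a point \<open>d\<close> of maximal norm,
  \<open>x\<close> changes by at most half that maximum, so the maximum is 0. The zero may lie on
  either side of \<open>d\<close>, hence uniqueness holds backwards in time as well.\<close>

lemma local_uniqueness:
  assumes ab: "0 \<le> a" "integral {a..b} mass \<le> 1/2"
    and x: "solution_on A a b x"
    and c: "a \<le> c" "c \<le> b" "x c = 0" and t: "a \<le> t" "t \<le> b"
  shows "x t = 0"
proof -
  obtain d where d: "a \<le> d" "d \<le> b" and max: "\<And>t. a \<le> t \<Longrightarrow> t \<le> b \<Longrightarrow> norm (x t) \<le> norm (x d)"
    using solution_on_sup_attained[OF x order_trans[OF c(1,2)]] by blast
  have le: "norm (x u - x s) \<le> norm (x d) / 2" if st: "a \<le> s" "s \<le> u" "u \<le> b" for s u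
  proof -
    have "norm (integral {s..u} (\<lambda>r. A r *v x r)) \<le> norm (x d) / 2"
      by (rule norm_integral_chain_mult_le[OF ab(1) st(1) st(3) ab(2)])
        (use solution_onD[OF x st] max st in auto)
    then show ?thesis
      using solution_onD[OF x st] by (simp add: integral_unique)
  qed
  have "norm (x d) \<le> norm (x d) / 2"
  proof (cases "c \<le> d")
    case True
    then show ?thesis using le[of c d] c d by simp
  next
    case False
    then show ?thesis using le[of d c] c d by simp
  qed
  then have "norm (x d) = 0" using norm_ge_zero[of "x d"] by linarith
  then show ?thesis using max[OF t] by simp
qed

text \<open>
  At a most negative entry \<open>x\<^sub>i(t)\<close>, go back to the last time \<open>s\<close> at which \<open>x\<^sub>i\<close> vanished: since then
  the diagonal term only pushed \<open>x\<^sub>i\<close> up, and the others have lowered it by at most half of its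
  depth.
\<close>

lemma local_nonneg:
  assumes ab: "0 \<le> a" "integral {a..b} mass \<le> 1/2"
    and x: "solution_on A a b x"
    and xa: "\<And>i. 0 \<le> x a $ i" and t: "a \<le> t" "t \<le> b"
  shows "0 \<le> x t $ i"
proof (rule ccontr)
  assume neg: "\<not> 0 \<le> x t $ i"
  have cont: "continuous_on {a..b} (\<lambda>t. x t $ k)" for k
    by (intro continuous_on_component solution_on_continuous[OF x])
  have "\<exists>u\<in>{a..b}. \<forall>r\<in>{a..b}. x u $ k \<le> x r $ k" for k
    using t by (intro continuous_attains_inf cont) auto
  then obtain u where u: "\<And>k. u k \<in> {a..b}" "\<And>k r. r \<in> {a..b} \<Longrightarrow> x (u k) $ k \<le> x r $ k"
    by metis
  \<comment> \<open>Minimising first over time and then over components makes \<open>- m\<close>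
    below a lower bound for all components on all of \<open>{a..b}\<close>.\<close>
  obtain k where k: "\<And>j. x (u k) $ k \<le> x (u j) $ j"
  proof -
    let ?V = "range (\<lambda>j. x (u j) $ j)"
    have "Min ?V \<in> ?V" by (rule Min_in) auto
    then obtain k where k: "Min ?V = x (u k) $ k" by (rule rangeE)
    have "x (u k) $ k \<le> x (u j) $ j" for j
      unfolding k[symmetric] by (rule Min_le) auto
    then show ?thesis by (rule that)
  qed
  define m where "m = - x (u k) $ k"
  have lower: "- m \<le> x r $ j" if "a \<le> r" "r \<le> b" for r j
    using u(2)[of r j] k[of j] that by (auto simp: m_def)
  have "m > 0" using lower[OF t, of i] neg by auto
  \<comment> \<open>This set is compact, and contains \<open>a\<close> since the initial value is
    nonnegative; its maximum is the time \<open>s\<close>.\<close>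
  define Z where "Z = {r \<in> {a..u k}. 0 \<le> x r $ k}"
  have "continuous_on {a..u k} (\<lambda>t. x t $ k)"
    using u(1)[of k] by (intro continuous_on_subset[OF cont]) auto
  then have "closed ({a..u k} \<inter> (\<lambda>t. x t $ k) -` {0..})"
    by (intro continuous_closed_preimage) auto
  moreover have Z_eq: "Z = {a..u k} \<inter> (\<lambda>t. x t $ k) -` {0..}"
    by (auto simp: Z_def)
  ultimately have "compact Z"
    by (metis bounded_Int bounded_closed_interval compact_eq_bounded_closed)
  moreover have "a \<in> Z" using xa u(1)[of k] by (auto simp: Z_def)
  ultimately obtain s where s: "s \<in> Z" "\<And>r. r \<in> Z \<Longrightarrow> r \<le> s"
    using compact_attains_sup[of Z] by auto
  have su: "a \<le> s" "s \<le> u k" "u k \<le> b" "0 \<le> x s $ k"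
    using s u(1)[of k] by (auto simp: Z_def)
  \<comment> \<open>A positive value after \<open>s\<close> would force, by the intermediate value
    theorem, a later zero \<open>q\<close>, which lies in \<open>Z\<close> and so cannot exceed
    \<open>s\<close>.\<close>
  have below: "x r $ k \<le> 0" if r: "s \<le> r" "r \<le> u k" for r
  proof (rule ccontr)
    assume "\<not> x r $ k \<le> 0"
    moreover have "x (u k) $ k < 0" using \<open>m > 0\<close> by (simp add: m_def)
    moreover have "continuous_on {r..u k} (\<lambda>t. x t $ k)"
      using r su by (intro continuous_on_subset[OF cont]) auto
    ultimately obtain q where q: "r \<le> q" "q \<le> u k" "x q $ k = 0"
      using IVT2'[of "\<lambda>t. x t $ k" "u k" 0 r] r by auto
    then have "q \<in> Z" using r su by (auto simp: Z_def)
    then have "q \<le> s" by (rule s(2))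
    then have "q = r" using q r by simp
    then show False using q \<open>\<not> x r $ k \<le> 0\<close> by simp
  qed
  let ?f = "\<lambda>r. A r *v x r"
  have I: "(?f has_integral (x (u k) - x s)) {s..u k}"
    by (rule solution_onD[OF x su(1-3)])
  have Ik: "((\<lambda>r. ?f r $ k) has_integral (x (u k) $ k - x s $ k)) {s..u k}"
    using has_integral_linear[OF I bounded_linear_vec_nth[of k]] by (simp add: o_def)
  have "((\<lambda>r. - (mass r * m)) has_integral (- (integral {s..u k} mass * m))) {s..u k}"
    using mass_integrable[of s "u k"] su ab
    by (intro has_integral_neg has_integral_mult_left) auto
  then have "- (integral {s..u k} mass * m) \<le> x (u k) $ k - x s $ k"
  proof (rule has_integral_le[OF _ Ik])
    fix r assume r: "r \<in> {s..u k}"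
    then have r0: "0 \<le> r" "a \<le> r" "r \<le> b" using su ab by auto
    \<comment> \<open>On the diagonal both factors on the right are nonpositive; off it the entry is
      nonnegative and \<open>x r $ j\<close> is at least \<open>- m\<close>.\<close>
    have "- (\<bar>A r $ k $ j\<bar> * m) \<le> A r $ k $ j * x r $ j" for j
    proof (cases "j = k")
      case True
      have "A r $ k $ k = - (\<Sum>l\<in>UNIV - {k}. A r $ k $ l)"
        using chain r0 by (simp add: continuous_time_chain_def sum.remove[of UNIV k]) (smt (verit))
      then have "A r $ k $ k \<le> 0"
        using chain r0(1) unfolding continuous_time_chain_def
        by (metis (no_types, lifting) DiffE insertI1 neg_le_0_iff_le sum_nonneg)
      then have "0 \<le> A r $ k $ k * x r $ k"
        using below[of r] r by (intro mult_nonpos_nonpos) auto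
      moreover have "0 \<le> \<bar>A r $ k $ k\<bar> * m" using \<open>m > 0\<close> by simp
      ultimately show ?thesis using True by simp
    next
      case False
      then have "0 \<le> A r $ k $ j"
        using chain r0 by (auto simp: continuous_time_chain_def)
      then show ?thesis
        using mult_left_mono[OF lower[OF r0(2,3), of j], of "A r $ k $ j"] by simp
    qed
    then have "- (\<Sum>j\<in>UNIV. \<bar>A r $ k $ j\<bar> * m) \<le> ?f r $ k"
      unfolding matrix_vector_mult_def sum_negf[symmetric] by (auto intro: sum_mono)
    moreover have "(\<Sum>j\<in>UNIV. \<bar>A r $ k $ j\<bar>) \<le> mass r"
      unfolding mass_def by (rule member_le_sum[of k]) (auto intro: sum_nonneg)
    then have "(\<Sum>j\<in>UNIV. \<bar>A r $ k $ j\<bar> * m) \<le> mass r * m"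
      unfolding sum_distrib_right[symmetric] using \<open>m > 0\<close> by (intro mult_right_mono) auto
    ultimately show "- (mass r * m) \<le> ?f r $ k" by linarith
  qed
  moreover have "integral {s..u k} mass \<le> integral {a..b} mass"
    by (rule integral_subset_le) (use su ab mass_integrable mass_nonneg in auto)
  then have "integral {s..u k} mass * m \<le> 1/2 * m"
    using \<open>m > 0\<close> ab by (intro mult_right_mono) auto
  \<comment> \<open>The drop of component \<open>k\<close> from \<open>s\<close> to
    \<open>u k\<close> is at most \<open>m / 2\<close>, yet it leads from a nonnegative value to
    \<open>- m\<close>.\<close>
  ultimately show False
    using su(4) \<open>m > 0\<close> by (simp add: m_def)
qed

section \<open>From short intervals to arbitrary ones\<close>

text \<open>The indefinite integral of \<open>mass\<close> is uniformly continuous on compact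
  intervals. The shape of the statement is that of the local hypothesis of
  \<open>Bolzano\<close>.\<close>

lemma local_mass_le_half:
  assumes "0 \<le> x"
  shows "\<exists>d>0. \<forall>a b. 0 \<le> a \<and> a \<le> x \<and> x \<le> b \<and> b - a < d \<longrightarrow> integral {a..b} mass \<le> 1/2"
proof -
  define F where "F t = integral {0..t} mass" for t
  have "continuous_on {0..x + 1} F"
    unfolding F_def by (intro indefinite_integral_continuous_1 mass_integrable) simp
  then have "uniformly_continuous_on {0..x + 1} F"
    by (rule compact_uniformly_continuous) simp
  then obtain d where d: "d > 0"
    "\<And>s t. s \<in> {0..x+1} \<Longrightarrow> t \<in> {0..x+1} \<Longrightarrow> dist t s < d \<Longrightarrow> dist (F t) (F s) < 1/2"
    unfolding uniformly_continuous_on_def by (metis half_gt_zero_iff zero_less_one)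
  \<comment> \<open>The bound 1 on the length keeps \<open>b\<close> within
    \<open>{0..x + 1}\<close>.\<close>
  have "integral {a..b} mass \<le> 1/2" if ab: "0 \<le> a" "a \<le> x" "x \<le> b" "b - a < min d 1" for a b
  proof -
    have "F a + integral {a..b} mass = F b"
      unfolding F_def using ab
      by (intro Henstock_Kurzweil_Integration.integral_combine mass_integrable) auto
    moreover have "dist (F b) (F a) < 1/2"
      using ab by (intro d(2)) (auto simp: dist_real_def)
    ultimately show ?thesis unfolding dist_real_def by linarith
  qed
  then show ?thesis using d(1) by (intro exI[of _ "min d 1"]) auto
qed

text \<open>Existence, uniqueness and positivity are bundled into one predicate on intervals, to be
  propagated by a single bisection argument. Vanishing at the right end is included because it later
  gives injectivity of the transition matrices.\<close>

definition well_posed :: "real \<Rightarrow> real \<Rightarrow> bool" where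
  "well_posed a b \<longleftrightarrow>
     (\<forall>v. \<exists>x. solution_on A a b x \<and> x a = v) \<and>
     (\<forall>x. solution_on A a b x \<longrightarrow> x a = 0 \<or> x b = 0 \<longrightarrow> (\<forall>t\<in>{a..b}. x t = 0)) \<and>
     (\<forall>x. solution_on A a b x \<longrightarrow> (\<forall>i. 0 \<le> x a $ i) \<longrightarrow> (\<forall>t\<in>{a..b}. \<forall>i. 0 \<le> x t $ i))"

text \<open>Solutions are glued at \<open>b\<close>. A zero at an outer end first forces a zero at
  \<open>b\<close>, then on both halves; positivity passes from left to right through
  \<open>b\<close>.\<close>

lemma well_posed_trans:
  assumes ab: "well_posed a b" and bc: "well_posed b c" and "a \<le> b" "b \<le> c"
  shows "well_posed a c"
  unfolding well_posed_def
proof (intro conjI allI impI)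
  fix v
  obtain x where x: "solution_on A a b x" "x a = v"
    using ab unfolding well_posed_def by blast
  moreover obtain y where y: "solution_on A b c y" "y b = x b"
    using bc unfolding well_posed_def by blast
  ultimately have "solution_on A a c (\<lambda>t. if t \<le> b then x t else y t)"
    using assms by (intro solution_on_glue) auto
  then show "\<exists>x. solution_on A a c x \<and> x a = v"
    using x(2) \<open>a \<le> b\<close> by (intro exI[of _ "\<lambda>t. if t \<le> b then x t else y t"]) auto
next
  fix x assume x: "solution_on A a c x"
  have xab: "solution_on A a b x" and xbc: "solution_on A b c x"
    using solution_on_subinterval[OF x] assms by auto
  {
    assume "x a = 0 \<or> x c = 0"
    then have "x b = 0"
      using ab bc xab xbc assms unfolding well_posed_def by (metis atLeastAtMost_iff order_refl)
    then show "\<forall>t\<in>{a..c}. x t = 0"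
      using ab bc xab xbc unfolding well_posed_def by (metis atLeastAtMost_iff linear)
  next
    assume xa: "\<forall>i. 0 \<le> x a $ i"
    then have 1: "\<forall>t\<in>{a..b}. \<forall>i. 0 \<le> x t $ i"
      using ab xab unfolding well_posed_def by blast
    then have "\<forall>i. 0 \<le> x b $ i" using \<open>a \<le> b\<close> by auto
    then have "\<forall>t\<in>{b..c}. \<forall>i. 0 \<le> x t $ i"
      using bc xbc unfolding well_posed_def by blast
    with 1 show "\<forall>t\<in>{a..c}. \<forall>i. 0 \<le> x t $ i"
      by (metis atLeastAtMost_iff linear)
  }
qed

lemma well_posed:
  assumes "0 \<le> a" "a \<le> b"
  shows "well_posed a b"
proof -
  \<comment> \<open>The guard sits inside the predicate because the small intervals in
    \<open>Bolzano\<close> may reach negative times, where nothing is known about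
    \<open>A\<close>.\<close>
  have "0 \<le> a \<longrightarrow> well_posed a b"
    using \<open>a \<le> b\<close>
  proof (induction rule: Bolzano)
    case (trans a b c)
    then show ?case using well_posed_trans by auto
  next
    case (local x)
    then obtain d where "d > 0" and
      d: "\<And>a b. 0 \<le> a \<Longrightarrow> a \<le> x \<Longrightarrow> x \<le> b \<Longrightarrow> b - a < d \<Longrightarrow> integral {a..b} mass \<le> 1/2"
      using local_mass_le_half[of x] assms by auto
    have "well_posed u v" if uv: "u \<le> x" "x \<le> v" "v - u < d" "0 \<le> u" for u v
    proof -
      have half: "integral {u..v} mass \<le> 1/2" by (rule d) (use uv in auto)
      have "\<exists>y. solution_on A u v y \<and> y u = w" for w
        using uv half by (intro local_existence) auto
      moreover have "y t = 0" if "solution_on A u v y" "y u = 0 \<or> y v = 0" "t \<in> {u..v}" for y t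
        using local_uniqueness[OF uv(4) half that(1), of u t]
          local_uniqueness[OF uv(4) half that(1), of v t] that by auto
      moreover have "0 \<le> y t $ i"
        if "solution_on A u v y" "\<forall>i. 0 \<le> y u $ i" "t \<in> {u..v}" for y t i
        using local_nonneg[OF uv(4) half that(1)] that by auto
      ultimately show ?thesis unfolding well_posed_def by blast
    qed
    with \<open>d > 0\<close> show ?case by blast
  qed
  then show ?thesis using assms by blast
qed

lemma solution_zero:
  assumes "0 \<le> a" "a \<le> t" "t \<le> b" "solution_on A a b x" "x a = 0 \<or> x b = 0"
  shows "x t = 0"
proof -
  have "well_posed a b" using assms by (intro well_posed) auto
  then have "\<forall>t\<in>{a..b}. x t = 0"
    using assms(4,5) unfolding well_posed_def by blast
  then show ?thesis using assms by auto
qed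

lemma solution_nonneg:
  assumes "0 \<le> a" "a \<le> t" "t \<le> b" "solution_on A a b x" "\<And>i. 0 \<le> x a $ i"
  shows "0 \<le> x t $ i"
proof -
  have "well_posed a b" using assms by (intro well_posed) auto
  then have "\<forall>t\<in>{a..b}. \<forall>i. 0 \<le> x t $ i"
    using assms(4,5) unfolding well_posed_def by blast
  then show ?thesis using assms by auto
qed

lemma solution_unique:
  assumes "0 \<le> a" "solution_on A a b x" "solution_on A a b y" "x a = y a" "a \<le> t" "t \<le> b"
  shows "x t = y t"
  using solution_zero[OF assms(1,5,6) solution_on_diff[OF assms(2,3)]] assms(4) by simp

text \<open>By uniqueness the solutions on the intervals \<open>{a..b}\<close> agree where they
  overlap, so the diagonal function \<open>y t t\<close> coincides with each of them.\<close>

lemma solution_exists: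
  assumes "0 \<le> a"
  shows "\<exists>x. (\<forall>b. solution_on A a b x) \<and> x a = v"
proof -
  have "\<exists>y. solution_on A a b y \<and> y a = v" if "a \<le> b" for b
    using well_posed[OF assms that] unfolding well_posed_def by blast
  then obtain y where y: "\<And>b. a \<le> b \<Longrightarrow> solution_on A a b (y b)" "\<And>b. a \<le> b \<Longrightarrow> y b a = v"
    by metis
  have "solution_on A a b (\<lambda>t. y t t)" for b
  proof (cases "a \<le> b")
    case True
    show ?thesis
    proof (rule solution_on_cong[OF y(1)[OF True]])
      fix t assume t: "a \<le> t" "t \<le> b"
      show "y b t = y t t"
        by (rule solution_unique[OF assms solution_on_subinterval[OF y(1)[OF True]] y(1)])
          (use t y(2) True in auto)
    qed
  qed (auto simp: solution_on_def)
  then show ?thesis using y(2) by (intro exI[of _ "\<lambda>t. y t t"]) auto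
qed

section \<open>State transition matrix\<close>

text \<open>The columns are the solutions that start at the standard basis vectors.\<close>

lemma fundamental_solution_exists:
  assumes "0 \<le> \<tau>"
  shows "\<exists>X. fundamental_solution A \<tau> X"
proof -
  have "\<forall>j. \<exists>x. (\<forall>b. solution_on A \<tau> b x) \<and> x \<tau> = axis j 1"
    using solution_exists[OF assms] by blast
  then obtain x where x: "\<And>j b. solution_on A \<tau> b (x j)" "\<And>j. x j \<tau> = axis j 1"
    by metis
  have "((\<lambda>s. A s ** (\<chi> i j. x j s $ i)) has_integral ((\<chi> i j. x j t $ i) - mat 1)) {\<tau>..t}"
    if t: "\<tau> \<le> t" for t
  proof (rule has_integral_vecI, rule has_integral_vecI)
    fix i j
    have "((\<lambda>s. (A s *v x j s) $ i) has_integral ((x j t - x j \<tau>) $ i)) {\<tau>..t}"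
      using has_integral_linear[OF solution_onD[OF x(1) order_refl t order_refl]
          bounded_linear_vec_nth[of i]] by (simp add: o_def)
    then show "((\<lambda>s. (A s ** (\<chi> i j. x j s $ i)) $ i $ j) has_integral
        ((\<chi> i j. x j t $ i) - mat 1) $ i $ j) {\<tau>..t}"
      by (simp add: x(2) matrix_matrix_mult_def matrix_vector_mult_def mat_def axis_def)
  qed
  then show ?thesis unfolding fundamental_solution_def
    by (intro exI[of _ "\<lambda>t. \<chi> i j. x j t $ i"]) blast
qed

lemma fundamental_solution_initial: "fundamental_solution A \<tau> X \<Longrightarrow> X \<tau> = mat 1"
  unfolding fundamental_solution_def
  by (metis atLeastAtMost_singleton eq_iff_diff_eq_0 has_integral_refl(2) has_integral_unique order_refl)

text \<open>Evaluation at \<open>w\<close> is linear in the matrix and so commutes with the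
  integral.\<close>

lemma fundamental_solution_apply:
  assumes "fundamental_solution A \<tau> X"
  shows "solution_on A \<tau> b (\<lambda>t. X t *v w)"
proof (rule solution_on_initialI)
  fix t assume "\<tau> \<le> t"
  then have I: "((\<lambda>s. A s ** X s) has_integral (X t - mat 1)) {\<tau>..t}"
    using assms unfolding fundamental_solution_def by blast
  have "linear (\<lambda>M :: real ^ 'n ^ 'n. M *v w)"
    by (rule linearI) (simp_all add: matrix_vector_mult_add_rdistrib scaleR_matrix_vector_assoc)
  then have "((\<lambda>s. (A s ** X s) *v w) has_integral ((X t - mat 1) *v w)) {\<tau>..t}"
    using has_integral_linear[OF I] by (fastforce simp: o_def linear_conv_bounded_linear)
  then show "((\<lambda>s. A s *v (X s *v w)) has_integral (X t *v w - X \<tau> *v w)) {\<tau>..t}"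
    by (simp add: matrix_vector_mul_assoc matrix_vector_mult_diff_rdistrib
        fundamental_solution_initial[OF assms])
qed

abbreviation "\<Phi> \<equiv> state_transition A"

text \<open>Uniqueness of solutions, applied to every vector \<open>w\<close>, justifies the
  definite description.\<close>

lemma state_transition_eq:
  assumes X: "fundamental_solution A \<tau> X" and "0 \<le> \<tau>" "\<tau> \<le> t"
  shows "\<Phi> t \<tau> = X t"
  unfolding state_transition_def
proof (rule the_equality)
  fix M assume "\<exists>Y. fundamental_solution A \<tau> Y \<and> Y t = M"
  then obtain Y where Y: "fundamental_solution A \<tau> Y" "Y t = M" by blast
  have "Y t *v w = X t *v w" for w
    by (rule solution_unique[OF assms(2) fundamental_solution_apply[OF Y(1), of t]
          fundamental_solution_apply[OF X]])
      (use assms in \<open>auto simp: fundamental_solution_initial[OF X] fundamental_solution_initial[OF Y(1)]\<close>)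
  then show "M = X t" using Y(2) by (simp add: matrix_eq)
qed (use X in blast)

lemma state_transition_self: "0 \<le> \<tau> \<Longrightarrow> \<Phi> \<tau> \<tau> = mat 1"
  using fundamental_solution_exists[of \<tau>] state_transition_eq[of \<tau> _ \<tau>]
    fundamental_solution_initial by force

lemma state_transition_solution:
  assumes "0 \<le> \<tau>"
  shows "solution_on A \<tau> b (\<lambda>t. \<Phi> t \<tau> *v w)"
proof -
  obtain X where X: "fundamental_solution A \<tau> X"
    using fundamental_solution_exists[OF assms] by blast
  show ?thesis
    by (rule solution_on_cong[OF fundamental_solution_apply[OF X]])
      (simp add: state_transition_eq[OF X assms])
qed

text \<open>As functions of \<open>t\<close> both sides are solutions from time \<open>r\<close> on
  with the same value there.\<close>

lemma state_transition_cocycle: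
  assumes "0 \<le> s" "s \<le> r" "r \<le> t"
  shows "\<Phi> t s *v w = \<Phi> t r *v (\<Phi> r s *v w)"
proof (rule solution_unique[where a = r and b = t and x = "\<lambda>t. \<Phi> t s *v w"
      and y = "\<lambda>t. \<Phi> t r *v (\<Phi> r s *v w)"])
  show "solution_on A r t (\<lambda>t. \<Phi> t s *v w)"
    by (rule solution_on_subinterval[OF state_transition_solution[OF assms(1)] assms(2) order_refl])
  show "solution_on A r t (\<lambda>t. \<Phi> t r *v (\<Phi> r s *v w))"
    using state_transition_solution assms by auto
qed (use assms state_transition_self in auto)

lemma state_transition_nonneg:
  assumes "0 \<le> s" "s \<le> t" "\<And>i. 0 \<le> w $ i"
  shows "0 \<le> (\<Phi> t s *v w) $ i"
  using solution_nonneg[OF assms(1,2) order_refl state_transition_solution[OF assms(1)]] assms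
  by (simp add: state_transition_self)

lemma state_transition_inj:
  assumes "0 \<le> s" "s \<le> t" "\<Phi> t s *v w = 0"
  shows "w = 0"
proof -
  have "\<Phi> s s *v w = 0"
    using solution_zero[OF assms(1) order_refl assms(2) state_transition_solution[OF assms(1)]] assms
    by blast
  then show ?thesis using assms by (simp add: state_transition_self)
qed

text \<open>Zero row sums make the constant vector 1 a solution.\<close>

lemma state_transition_one:
  assumes "0 \<le> s" "s \<le> t"
  shows "\<Phi> t s *v 1 = 1"
proof (rule solution_unique[where a = s and b = t and x = "\<lambda>t. \<Phi> t s *v 1" and y = "\<lambda>t. 1"])
  show "solution_on A s t (\<lambda>t. 1)"
    unfolding solution_on_def
  proof (intro allI impI)
    fix u v assume u: "s \<le> u"
    have "A r *v 1 = 0" if "r \<in> {u..v}" for r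
      using chain that u assms
      by (simp add: continuous_time_chain_def matrix_vector_mult_def vec_eq_iff)
    then have "((\<lambda>r. A r *v 1) has_integral 0) {u..v}"
      by (rule has_integral_is_0)
    then show "((\<lambda>r. A r *v 1) has_integral (1 - 1 :: real ^ 'n)) {u..v}"
      by simp
  qed
qed (use assms state_transition_solution state_transition_self in auto)

text \<open>The vectors \<open>m *\<^sub>R 1 + w\<close> and \<open>m *\<^sub>R 1 - w\<close> are
  nonnegative; the transition matrix preserves nonnegativity and fixes 1.\<close>

lemma state_transition_nonexpansive:
  assumes "0 \<le> s" "s \<le> t" and w: "\<And>i. \<bar>w $ i\<bar> \<le> m"
  shows "\<bar>(\<Phi> t s *v w) $ i\<bar> \<le> m"
proof -
  have "0 \<le> (\<Phi> t s *v (m *\<^sub>R 1 + c *\<^sub>R w)) $ i" if "c = 1 \<or> c = - 1" for c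
  proof (rule state_transition_nonneg[OF assms(1,2)])
    show "0 \<le> (m *\<^sub>R 1 + c *\<^sub>R w) $ j" for j
      using w[of j] that by (auto simp: abs_le_iff)
  qed
  from this[of 1] this[of "- 1"] show ?thesis
    using state_transition_one[OF assms(1,2)]
    by (simp add: matrix_vector_right_distrib matrix_vector_mult_scaleR
        matrix_vector_mult_diff_distrib abs_le_iff)
qed

section \<open>Null space\<close>

lemma null_space_at_iff:
  assumes "0 \<le> s"
  shows "v \<in> null_space_at A 0 \<longleftrightarrow> \<Phi> s 0 *v v \<in> null_space_at A s"
proof -
  have "\<forall>\<^sub>F t in at_top. \<Phi> t 0 *v v = \<Phi> t s *v (\<Phi> s 0 *v v)"
    using eventually_ge_at_top[of s] state_transition_cocycle[OF order_refl assms]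
    by (rule eventually_mono)
  then show ?thesis unfolding null_space_at_def by (simp add: tendsto_cong)
qed

text \<open>The invertible matrix \<open>\<Phi> s 0\<close> maps the null space at time 0 onto the
  one at time \<open>s\<close>.\<close>

lemma dim_null_space_at:
  assumes "0 \<le> s"
  shows "dim (null_space_at A s) = dim (null_space_at A 0)"
proof -
  let ?f = "\<lambda>v. \<Phi> s 0 *v v"
  have lin: "linear ?f" by simp
  have inj: "inj ?f"
    using state_transition_inj[OF order_refl assms] by (simp add: linear_injective_0[OF lin])
  then have "surj ?f" using lin linear_inj_imp_surj by blast
  then have "null_space_at A s = ?f ` null_space_at A 0"
    using null_space_at_iff[OF assms] by (auto 4 3 simp: image_iff surj_def)
  then show ?thesis
    using dim_image_eq[OF lin] inj by (simp add: inj_on_subset)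
qed

lemma nullity_eq: "nullity A = dim (null_space_at A 0)"
  unfolding nullity_def by (rule the_equality) (blast intro: dim_null_space_at, metis order_refl)

section \<open>Limits of transition matrices and the rank bound\<close>

lemma limit_kernel_subset_null_space:
  assumes r: "filterlim r at_top sequentially"
    and M: "(\<lambda>k. \<Phi> (r k) 0) \<longlonglongrightarrow> M" and v: "M *v v = 0"
  shows "v \<in> null_space_at A 0"
proof -
  have lim: "(\<lambda>k. (\<Phi> (r k) 0 *v v) $ i) \<longlonglongrightarrow> 0" for i
  proof -
    have "(\<lambda>k. (\<Phi> (r k) 0 *v v) $ i) \<longlonglongrightarrow> (M *v v) $ i"
      unfolding matrix_vector_mult_def by (auto intro!: tendsto_intros M)
    then show ?thesis using v by simp
  qed
  have "((\<lambda>t. (\<Phi> t 0 *v v) $ i) \<longlongrightarrow> 0) at_top" for i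
  proof (rule tendstoI)
    fix e :: real assume "e > 0"
    \<comment> \<open>Finiteness of the index set gives one \<open>k\<close> serving all components;
      from time \<open>r k\<close> on, nonexpansiveness keeps every component below
      \<open>e\<close>.\<close>
    have "\<forall>\<^sub>F k in sequentially. \<forall>j. \<bar>(\<Phi> (r k) 0 *v v) $ j\<bar> < e / 2"
      using tendstoD[OF lim, of "e/2"] \<open>e > 0\<close> by (simp add: eventually_all_finite)
    moreover have "\<forall>\<^sub>F k in sequentially. 0 \<le> r k"
      using r by (simp add: filterlim_at_top)
    ultimately obtain k where k: "\<And>j. \<bar>(\<Phi> (r k) 0 *v v) $ j\<bar> < e / 2" "0 \<le> r k"
      by (metis (mono_tags, lifting) eventually_conj eventually_sequentially order_refl)
    have "\<bar>(\<Phi> t 0 *v v) $ i\<bar> < e" if "r k \<le> t" for t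
    proof -
      have "\<bar>(\<Phi> t (r k) *v (\<Phi> (r k) 0 *v v)) $ i\<bar> \<le> e / 2"
        by (rule state_transition_nonexpansive) (use k that in \<open>auto intro: less_imp_le\<close>)
      then show ?thesis
        using state_transition_cocycle[OF order_refl k(2) that] \<open>e > 0\<close> by simp
    qed
    then show "\<forall>\<^sub>F t in at_top. dist ((\<Phi> t 0 *v v) $ i) 0 < e"
      by (auto intro!: eventually_mono[OF eventually_ge_at_top[of "r k"]] simp: dist_real_def)
  qed
  then show ?thesis
    unfolding null_space_at_def by (auto intro: vec_tendstoI)
qed

lemma limit_matrix_exists:
  obtains r M where "filterlim r at_top sequentially" "(\<lambda>k. \<Phi> (r k) 0) \<longlonglongrightarrow> M"
proof -
  have entry: "\<bar>\<Phi> t 0 $ i $ j\<bar> \<le> 1" if "0 \<le> t" for t i j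
  proof -
    \<comment> \<open>Entries are components of images of basis vectors, whose sup-norm is 1; hence
      the matrices stay bounded and have a convergent subsequence.\<close>
    have "\<bar>(\<Phi> t 0 *v axis j 1) $ i\<bar> \<le> 1"
      by (rule state_transition_nonexpansive) (use that in \<open>auto simp: axis_def\<close>)
    then show ?thesis by (simp add: matrix_vector_mult_basis column_def)
  qed
  have "norm (\<Phi> (real n) 0) \<le> (\<Sum>i\<in>(UNIV :: 'n set). \<Sum>j\<in>(UNIV :: 'n set). 1)" for n
    unfolding norm_vec_def
    by (rule order_trans[OF L2_set_le_sum] sum_mono order_refl | simp add: entry)+
  then have "bounded (range (\<lambda>n. \<Phi> (real n) 0))"
    by (auto intro!: boundedI)
  then obtain M q where q: "strict_mono (q :: nat \<Rightarrow> nat)"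
    and "((\<lambda>n. \<Phi> (real n) 0) \<circ> q) \<longlonglongrightarrow> M"
    using bounded_imp_convergent_subsequence by blast
  moreover have "filterlim (\<lambda>k. real (q k)) at_top sequentially"
    using filterlim_compose[OF filterlim_real_sequentially filterlim_subseq[OF q]] .
  ultimately show ?thesis using that[of "\<lambda>k. real (q k)" M] by (simp add: o_def)
qed

lemma rows_limit_eq:
  assumes r: "filterlim r at_top sequentially"
    and M: "(\<lambda>k. \<Phi> (r k) 0) \<longlonglongrightarrow> M" and ij: "mutually_weakly_ergodic A i j"
  shows "row i M = row j M"
proof -
  have "((\<lambda>t. norm (row i (\<Phi> t 0) - row j (\<Phi> t 0))) \<longlongrightarrow> 0) at_top"
    using ij unfolding mutually_weakly_ergodic_def by auto
  from filterlim_compose[OF this r]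
  have "(\<lambda>k. norm (row i (\<Phi> (r k) 0) - row j (\<Phi> (r k) 0))) \<longlonglongrightarrow> 0" .
  moreover have "(\<lambda>k. row l (\<Phi> (r k) 0)) \<longlonglongrightarrow> row l M" for l
    unfolding row_def vec_lambda_eta by (intro tendsto_vec_nth M)
  then have "(\<lambda>k. norm (row i (\<Phi> (r k) 0) - row j (\<Phi> (r k) 0))) \<longlonglongrightarrow> norm (row i M - row j M)"
    by (intro tendsto_norm tendsto_diff)
  ultimately have "norm (row i M - row j M) = 0"
    using LIMSEQ_unique by blast
  then show ?thesis by simp
qed

lemma chain_rank_le: "chain_rank A \<le> card (ergodicity_classes A)"
proof -
  obtain r M where r: "filterlim r at_top sequentially" "(\<lambda>k. \<Phi> (r k) 0) \<longlonglongrightarrow> M"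
    by (rule limit_matrix_exists)
  have "dim {v. M *v v = 0} \<le> dim (null_space_at A 0)"
    using limit_kernel_subset_null_space[OF r] by (intro dim_subset) auto
  moreover have "card (rows M) \<le> card (ergodicity_classes A)"
    by (rule card_rows_le_classes rows_limit_eq[OF r])+
  \<comment> \<open>Together these bound \<open>CARD('n)\<close> by the nullity plus the number of
    classes, which survives the truncated subtraction in \<open>chain_rank\<close>.\<close>
  ultimately show ?thesis
    using card_le_dim_kernel_plus_rows[of M] unfolding chain_rank_def nullity_eq by simp
qed

end

theorem corollary2:
  fixes A :: "real \<Rightarrow> real ^ 'n ^ 'n"
  assumes "continuous_time_chain A"
  shows "chain_rank A \<le> card (ergodicity_classes A)"
  by (rule time_chain.chain_rank_le) (unfold_locales, fact assms)

end
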